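(* Let $\mathcal{P}$ be a logic program and $S$ a finite set of invented rules. If the optimal knowledge refactoring problem for $\mathcal{P}$ has a solution using the set of invented rules $C\subseteq S$, then it has a solution using a set of invented rules $C'\subseteq S_{lin}$, where $S_{lin}=\{\mathit{lin}(s)\mid s\in S\}$.
   Context: A logic program is a finite set of definite rules $h\leftarrow a_1,\dots,a_m$; a literal is a predicate symbol applied to variables. $\mathit{pred}(a)$, $\mathit{var}(a)$ denote the predicate symbol and variable set of literal $a$; $\mathit{head}(r)$, $\mathit{body}(r)$ the head and set of body literals of rule $r$. $\mathit{size}(r)=|\mathit{body}(r)|+1$, $\mathit{size}(\mathcal{P})=\sum_{r\in\mathcal{P}}\mathit{size}(r)$. Unfolding: given $\mathcal{P}=\{c_1,\dots,c_N\}$ and a rule $r$ with no variables occurring only in its body, unfolding $\mathcal{P}$ upon $r$ gives $\{d_1,\dots,d_N\}$ where $d_i$ is the resolvent of $c_i$ and $r$ (resolving all body literals of $c_i$ unifiable with $\mathit{head}(r)$) if $\mathit{head}(r)$ unifies with some literal of $\mathit{body}(c_i)$, and $d_i=c_i$ otherwise; $\mathsf{unfold}(\mathcal{P},S)$ is the result of successively unfolding $\mathcal{P}$ upon every rule of a set $S$. Invented rule (w.r.t. $\mathcal{P}$ and a finite variable set $\mathcal{X}$): (1) $\mathit{pred}(\mathit{head}(r))$ does not occur in $\mathcal{P}$; (2) each body literal's predicate symbol occurs in $\mathcal{P}$; (3) each body literal's variables lie in $\mathcal{X}$; (4) $\mathit{var}(\mathit{head}(r))=\bigcup_{a\in\mathit{body}(r)}\mathit{var}(a)$.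 Refactored rule: $r'$ is a refactored rule of $r$ w.r.t. a set $S$ of invented rules iff $\mathsf{unfold}(\{r'\},S)=\{r\}$; $\mathcal{I}(\mathcal{P},S)$ denotes all refactored rules of rules of $\mathcal{P}$. Refactored program: $\mathcal{Q}\subseteq\mathcal{P}\cup S\cup\mathcal{I}(\mathcal{P},S)$ with $\mathsf{unfold}(\mathcal{Q}\setminus S,\mathcal{Q}\cap S)=\mathcal{P}$. The optimal knowledge refactoring problem, given $\mathcal{P}$ and $S$, asks for a refactored program of minimum size; a solution "uses" the invented rules it contains. A linear invented rule is an invented rule in which each variable occurs at most once in the body (variables occur linearly). For an invented rule $r$, $\mathit{lin}(r)$ is the linear invented rule obtained by (i) rewriting the body literals of $r$ keeping their predicate symbols but replacing the variables so that they occur linearly, and (ii) building a new head literal with $\mathit{var}(\mathit{head}(\mathit{lin}(r)))=\bigcup_{a\in\mathit{body}(\mathit{lin}(r))}\mathit{var}(a)$. *)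

theory Defs
  imports Main "HOL-Library.FSet" "HOL-Library.Infinite_Typeclass"
begin

(* Variables range over an arbitrary infinite type, so rules can always be renamed apart. *)

datatype ('p, 'v) literal = Literal (sym: 'p) (args: "'v list")

(* Bodies are finite sets by construction. *)
datatype ('p, 'v) rule = Rule (head: "('p, 'v) literal") (fbody: "('p, 'v) literal fset")

abbreviation body :: "('p, 'v) rule \<Rightarrow> ('p, 'v) literal set" where
  "body r \<equiv> fset (fbody r)"

(* A predicate symbol comes with its arity: p/n and p/m are different symbols for n \<noteq> m. *)
definition pred :: "('p, 'v) literal \<Rightarrow> 'p \<times> nat" where
  "pred a = (sym a, length (args a))"

definition var :: "('p, 'v) literal \<Rightarrow> 'v set" where
  "var a = set (args a)"

definition rule_vars :: "('p, 'v) rule \<Rightarrow> 'v set" where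
  "rule_vars r = var (head r) \<union> (\<Union>a\<in>body r. var a)"

definition preds :: "('p, 'v) rule set \<Rightarrow> ('p \<times> nat) set" where
  "preds P = (\<Union>r\<in>P. insert (pred (head r)) (pred ` body r))"

definition rule_size :: "('p, 'v) rule \<Rightarrow> nat" where
  "rule_size r = card (body r) + 1"

definition prog_size :: "('p, 'v) rule set \<Rightarrow> nat" where
  "prog_size P = (\<Sum>r\<in>P. rule_size r)"


section \<open>Unification and unfolding\<close>

(* Variables are the only terms, so substitutions map variables to variables. *)
definition subst :: "('v \<Rightarrow> 'v) \<Rightarrow> ('p, 'v) literal \<Rightarrow> ('p, 'v) literal" where
  "subst \<sigma> a = Literal (sym a) (map \<sigma> (args a))"

definition unifier :: "('v \<Rightarrow> 'v) \<Rightarrow> (('p, 'v) literal \<times> ('p, 'v) literal) set \<Rightarrow> bool" where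
  "unifier \<sigma> E \<longleftrightarrow> (\<forall>(a, b)\<in>E. subst \<sigma> a = subst \<sigma> b)"

definition mgu :: "('v \<Rightarrow> 'v) \<Rightarrow> (('p, 'v) literal \<times> ('p, 'v) literal) set \<Rightarrow> bool" where
  "mgu \<sigma> E \<longleftrightarrow> unifier \<sigma> E \<and> (\<forall>\<tau>. unifier \<tau> E \<longrightarrow> (\<exists>\<delta>. \<tau> = \<delta> \<circ> \<sigma>))"

(* Unifiability of a body literal with the head of a rule, the rule being renamed apart first. *)
definition unifiable_apart :: "('p, 'v) literal \<Rightarrow> ('p, 'v) literal \<Rightarrow> bool" where
  "unifiable_apart a h \<longleftrightarrow>
     (\<exists>\<rho> \<sigma>. inj_on \<rho> (var h) \<and> \<rho> ` var h \<inter> var a = {} \<and> unifier \<sigma> {(a, subst \<rho> h)})"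

definition resolved_literals ::
  "('p, 'v) rule \<Rightarrow> ('p, 'v) rule \<Rightarrow> ('p, 'v) literal set" where
  "resolved_literals c r = {a \<in> body c. unifiable_apart a (head r)}"

(* d is a resolvent of c and r: each resolved literal a of c is unified with the head of its own
   copy of r, given by the renaming \<rho> a, where the copies are apart from c and from each other.
   Resolvents are determined only up to the choice of the most general unifier, that is,
   up to renaming of variables; hence the relation. *)
definition resolvent :: "('p, 'v) rule \<Rightarrow> ('p, 'v) rule \<Rightarrow> ('p, 'v) rule \<Rightarrow> bool" where
  "resolvent c r d \<longleftrightarrow>
     (let L = resolved_literals c r in
      \<exists>\<rho> \<theta>.
        (\<forall>a\<in>L. inj_on (\<rho> a) (rule_vars r) \<and> \<rho> a ` rule_vars r \<inter> rule_vars c = {}) \<and>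
        (\<forall>a\<in>L. \<forall>b\<in>L. a \<noteq> b \<longrightarrow> \<rho> a ` rule_vars r \<inter> \<rho> b ` rule_vars r = {}) \<and>
        mgu \<theta> {(a, subst (\<rho> a) (head r)) | a. a \<in> L} \<and>
        head d = subst \<theta> (head c) \<and>
        body d = subst \<theta> ` (body c - L) \<union> (\<Union>a\<in>L. subst \<theta> ` subst (\<rho> a) ` body r))"

definition unfold_upon ::
  "('p, 'v) rule set \<Rightarrow> ('p, 'v) rule \<Rightarrow> ('p, 'v) rule set \<Rightarrow> bool" where
  "unfold_upon P r T \<longleftrightarrow>
     (\<Union>a\<in>body r. var a) \<subseteq> var (head r) \<and>
     (\<exists>d. T = d ` P \<and>
          (\<forall>c\<in>P. if resolved_literals c r \<noteq> {} then resolvent c r (d c) else d c = c))"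

inductive unfold_list ::
  "('p, 'v) rule set \<Rightarrow> ('p, 'v) rule list \<Rightarrow> ('p, 'v) rule set \<Rightarrow> bool" where
  "unfold_list P [] P"
| "unfold_upon P r P' \<Longrightarrow> unfold_list P' rs T \<Longrightarrow> unfold_list P (r # rs) T"

(* unfold P S T: T results from P by unfolding successively upon the rules of S, taken in some
   order. The order matters only if two rules of S share a head predicate symbol. *)
definition unfold ::
  "('p, 'v) rule set \<Rightarrow> ('p, 'v) rule set \<Rightarrow> ('p, 'v) rule set \<Rightarrow> bool" where
  "unfold P S T \<longleftrightarrow> (\<exists>rs. distinct rs \<and> set rs = S \<and> unfold_list P rs T)"


section \<open>Refactoring\<close>

definition invented_rule :: "('p, 'v) rule set \<Rightarrow> 'v set \<Rightarrow> ('p, 'v) rule \<Rightarrow> bool" where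
  "invented_rule P X r \<longleftrightarrow>
     pred (head r) \<notin> preds P \<and>
     (\<forall>a\<in>body r. pred a \<in> preds P) \<and>
     (\<forall>a\<in>body r. var a \<subseteq> X) \<and>
     var (head r) = (\<Union>a\<in>body r. var a)"

definition refactored_rule ::
  "('p, 'v) rule set \<Rightarrow> ('p, 'v) rule \<Rightarrow> ('p, 'v) rule \<Rightarrow> bool" where
  "refactored_rule S r r' \<longleftrightarrow> unfold {r'} S {r}"

definition refactored_rules ::
  "('p, 'v) rule set \<Rightarrow> ('p, 'v) rule set \<Rightarrow> ('p, 'v) rule set" where
  "refactored_rules P S = {r'. \<exists>r\<in>P. refactored_rule S r r'}"

(* The set of refactored rules is in general infinite, so finiteness of Q is required explicitly. *)
definition refactored_program ::
  "('p, 'v) rule set \<Rightarrow> ('p, 'v) rule set \<Rightarrow> ('p, 'v) rule set \<Rightarrow> bool" where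
  "refactored_program P S Q \<longleftrightarrow>
     finite Q \<and> Q \<subseteq> P \<union> S \<union> refactored_rules P S \<and> unfold (Q - S) (Q \<inter> S) P"

definition optimal_refactoring ::
  "('p, 'v) rule set \<Rightarrow> ('p, 'v) rule set \<Rightarrow> ('p, 'v) rule set \<Rightarrow> bool" where
  "optimal_refactoring P S Q \<longleftrightarrow>
     refactored_program P S Q \<and>
     (\<forall>R. refactored_program P S R \<longrightarrow> prog_size Q \<le> prog_size R)"


section \<open>Linear invented rules\<close>

definition linear_invented_rule :: "('p, 'v) rule set \<Rightarrow> 'v set \<Rightarrow> ('p, 'v) rule \<Rightarrow> bool" where
  "linear_invented_rule P X r \<longleftrightarrow>
     invented_rule P X r \<and> (\<forall>x. (\<Sum>a\<in>body r. count_list (args a) x) \<le> 1)"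

(* t is a linearisation of r. It may need more variables than r, so it is an invented rule with
   respect to some finite variable set, not necessarily the one used for r. The condition on the
   head of t is part of being an invented rule. *)
definition linearisation :: "('p, 'v) rule set \<Rightarrow> ('p, 'v) rule \<Rightarrow> ('p, 'v) rule \<Rightarrow> bool" where
  "linearisation P r t \<longleftrightarrow>
     (\<exists>Y. finite Y \<and> linear_invented_rule P Y t) \<and>
     (\<exists>f. bij_betw f (body r) (body t) \<and> (\<forall>a\<in>body r. pred (f a) = pred a))"

(* lin picks a linearisation of every rule of S. The head literals built for the linearisations
   are new: no head predicate symbol occurs in P or serves two different linearisations.
   Rules of S with a common linearisation may, but need not, be mapped to the same rule. *)
definition linearises ::
  "('p, 'v) rule set \<Rightarrow> ('p, 'v) rule set \<Rightarrow> (('p, 'v) rule \<Rightarrow> ('p, 'v) rule) \<Rightarrow> bool" where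
  "linearises P S lin \<longleftrightarrow>
     (\<forall>s\<in>S. linearisation P s (lin s)) \<and>
     (\<forall>s\<in>S. \<forall>t\<in>S. pred (head (lin s)) = pred (head (lin t)) \<longrightarrow> lin s = lin t)"

end

theory Submission imports Defs begin

text \<open>
  Let \<open>c\<close> be a rule of a refactored program that unfolds to \<open>d\<close>. The body of \<open>d\<close> is covered by one
  part for each body literal \<open>a\<close> of \<open>c\<close>: an instance of \<open>a\<close> itself, or an instance \<open>\<sigma> ` body r\<close>
  of the body of some invented rule \<open>r\<close>. As the body of \<open>lin r\<close> is linear, \<open>\<sigma> ` body r\<close> is
  also an instance of the body of \<open>lin r\<close>, so replacing each part by a literal of the first kind or
  by the matching instance of the head of \<open>lin r\<close> gives a rule that is no larger than \<open>c\<close> and that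
  the linear rules unfold to \<open>d\<close>. Hence every refactored program can be linearised without
  increasing its size, and this passes to the minimum.
\<close>

section \<open>Substitutions, fresh variables and unifiability\<close>

lemma pred_subst [simp]: "pred (subst \<sigma> a) = pred a"
  by (simp add: pred_def subst_def)

lemma subst_subst: "subst \<sigma> (subst \<tau> a) = subst (\<sigma> \<circ> \<tau>) a"
  by (simp add: subst_def)

lemma subst_cong: "(\<And>x. x \<in> var a \<Longrightarrow> \<sigma> x = \<tau> x) \<Longrightarrow> subst \<sigma> a = subst \<tau> a"
  by (simp add: subst_def var_def)

lemma subst_ident: "(\<And>x. x \<in> var a \<Longrightarrow> \<sigma> x = x) \<Longrightarrow> subst \<sigma> a = a"
  by (cases a) (simp add: subst_def var_def map_idI)

lemma subst_eq_var: "subst \<sigma> a = subst \<tau> a \<Longrightarrow> x \<in> var a \<Longrightarrow> \<sigma> x = \<tau> x"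
  by (simp add: subst_def var_def)

lemma finite_var [simp]: "finite (var a)"
  by (simp add: var_def)

lemma finite_rule_vars [simp]: "finite (rule_vars r)"
  by (simp add: rule_vars_def)

text \<open>The domain type is arbitrary, so that not only variables but also pairs of a literal and
  a variable can be given fresh names.\<close>

lemma exists_fresh_injection:
  fixes V :: "'v::infinite set"
  assumes "finite A" and "finite V"
  shows "\<exists>k::'a \<Rightarrow> 'v. inj_on k A \<and> k ` A \<inter> V = {}"
proof -
  have "infinite (- V)"
    using assms(2) by (simp add: infinite_UNIV Compl_eq_Diff_UNIV)
  then obtain B where "B \<subseteq> - V" "finite B" "card B = card A"
    using infinite_arbitrarily_large by metis
  then obtain k where "bij_betw k A B"
    using assms(1) finite_same_card_bij by metis
  then show ?thesis
    using \<open>B \<subseteq> - V\<close> unfolding bij_betw_def by blast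
qed

text \<open>Variables are the only terms, so a constant substitution unifies any two literals of
  equal symbol and arity. Which literals get resolved is therefore decided by predicate symbols
  alone.\<close>

lemma unifiable_apart_iff:
  fixes a h :: "('p, 'v::infinite) literal"
  shows "unifiable_apart a h \<longleftrightarrow> pred a = pred h"
proof
  assume "unifiable_apart a h"
  then obtain \<rho> \<sigma> where "subst \<sigma> a = subst \<sigma> (subst \<rho> h)"
    unfolding unifiable_apart_def unifier_def by auto
  then show "pred a = pred h"
    by (metis pred_subst)
next
  assume p: "pred a = pred h"
  obtain k :: "'v \<Rightarrow> 'v" where k: "inj_on k (var h)" "k ` var h \<inter> var a = {}"
    using exists_fresh_injection[of "var h" "var a"] by auto
  have "unifier (\<lambda>_. undefined) {(a, subst k h)}"
    using p by (auto simp: unifier_def subst_def pred_def map_replicate_const)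
  with k show "unifiable_apart a h"
    unfolding unifiable_apart_def by blast
qed

lemma resolved_literals_eq:
  fixes c r :: "('p, 'v::infinite) rule"
  shows "resolved_literals c r = {a \<in> body c. pred a = pred (head r)}"
  by (simp add: resolved_literals_def unifiable_apart_iff)

section \<open>Unfolding without renaming the unfolded rule\<close>

definition instance_of :: "('p, 'v) literal \<Rightarrow> ('p, 'v) literal \<Rightarrow> bool" where
  "instance_of l h \<longleftrightarrow> (\<exists>\<sigma>. l = subst \<sigma> h)"

text \<open>This is one-sided matching in place of unification: \<open>l\<close> itself is not
  instantiated. All matching rules and substitutions are collected to avoid a choice; for a
  stratified \<open>T\<close> they produce the same literals, see
  \<open>expand_instance\<close>.\<close>

definition expand :: "('p, 'v) rule set \<Rightarrow> ('p, 'v) literal \<Rightarrow> ('p, 'v) literal set" where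
  "expand T l =
     {subst \<sigma> b | \<sigma> b t. t \<in> T \<and> l = subst \<sigma> (head t) \<and> b \<in> body t} \<union>
     (if \<exists>t\<in>T. instance_of l (head t) then {} else {l})"

definition expand_rule :: "('p, 'v) rule set \<Rightarrow> ('p, 'v) rule \<Rightarrow> ('p, 'v) rule" where
  "expand_rule T c = Rule (head c) (Abs_fset (\<Union>l\<in>body c. expand T l))"

text \<open>Resolution is triggered by the predicate symbol. A literal with that symbol that is no
  instance of the head would force the unifier to identify variables of \<open>c\<close>, and
  matching would no longer suffice.\<close>

definition expandable :: "('p, 'v) rule set \<Rightarrow> ('p, 'v) rule \<Rightarrow> bool" where
  "expandable T c \<longleftrightarrow>
     (\<forall>t\<in>T. \<forall>l\<in>body c. pred l = pred (head t) \<longrightarrow> instance_of l (head t))"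

text \<open>The first clause makes matching the head determine the instance of the body. The second
  keeps introduced literals from being unfolded again, and the third makes the matching rule
  unique.\<close>

definition stratified :: "('p, 'v) rule set \<Rightarrow> bool" where
  "stratified T \<longleftrightarrow>
     (\<forall>t\<in>T. (\<Union>b\<in>body t. var b) \<subseteq> var (head t)) \<and>
     (\<forall>t\<in>T. \<forall>u\<in>T. \<forall>b\<in>body t. pred b \<noteq> pred (head u)) \<and>
     (\<forall>t\<in>T. \<forall>u\<in>T. pred (head t) = pred (head u) \<longrightarrow> t = u)"

lemma stratified_subset: "stratified T \<Longrightarrow> U \<subseteq> T \<Longrightarrow> stratified U"
  unfolding stratified_def by blast

lemma instance_of_pred: "instance_of l h \<Longrightarrow> pred l = pred h"
  unfolding instance_of_def by auto

lemma expand_other: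
  "(\<And>t. t \<in> T \<Longrightarrow> \<not> instance_of l (head t)) \<Longrightarrow> expand T l = {l}"
  unfolding expand_def instance_of_def by auto

text \<open>The predicate symbol of the head determines the rule, and the literal determines the
  substitution on the head variables, which include all body variables.\<close>

lemma expand_instance:
  assumes T: "stratified T" and t: "t \<in> T"
  shows "expand T (subst \<sigma> (head t)) = subst \<sigma> ` body t"
proof -
  have same: "u = t" if "u \<in> T" "subst \<sigma> (head t) = subst \<tau> (head u)" for \<tau> u
    using that T t unfolding stratified_def by (metis pred_subst)
  have "subst \<tau> b = subst \<sigma> b" if "u \<in> T" "subst \<sigma> (head t) = subst \<tau> (head u)" "b \<in> body u" for \<tau> u b
  proof -
    have "u = t"
      using same that by blast
    then have "var b \<subseteq> var (head t)"
      using that T unfolding stratified_def by blast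
    then show ?thesis
      using that(2) \<open>u = t\<close> by (metis subst_cong subst_eq_var subsetD)
  qed
  then have "{subst \<tau> b | \<tau> b u. u \<in> T \<and> subst \<sigma> (head t) = subst \<tau> (head u) \<and> b \<in> body u}
      \<subseteq> subst \<sigma> ` body t"
    using same by blast
  moreover have "subst \<sigma> ` body t
      \<subseteq> {subst \<tau> b | \<tau> b u. u \<in> T \<and> subst \<sigma> (head t) = subst \<tau> (head u) \<and> b \<in> body u}"
    using t by blast
  moreover have "\<exists>u\<in>T. instance_of (subst \<sigma> (head t)) (head u)"
    using t unfolding instance_of_def by blast
  ultimately show ?thesis
    unfolding expand_def by simp
qed

text \<open>This ensures that \<open>Abs_fset\<close> in \<open>expand_rule\<close> represents the
  intended union.\<close>

lemma finite_expand:
  assumes "stratified T"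
  shows "finite (expand T l)"
proof (cases "\<exists>t\<in>T. instance_of l (head t)")
  case True
  then obtain t \<sigma> where "t \<in> T" "l = subst \<sigma> (head t)"
    unfolding instance_of_def by blast
  then show ?thesis
    using expand_instance[OF assms] by simp
next
  case False
  then show ?thesis
    by (simp add: expand_other)
qed

lemma head_expand_rule [simp]: "head (expand_rule T c) = head c"
  by (simp add: expand_rule_def)

lemma body_expand_rule:
  assumes "stratified T"
  shows "body (expand_rule T c) = (\<Union>l\<in>body c. expand T l)"
  using finite_expand[OF assms] by (simp add: expand_rule_def Abs_fset_inverse)

lemma expand_rule_ident:
  assumes "\<And>t l. t \<in> T \<Longrightarrow> l \<in> body c \<Longrightarrow> pred l \<noteq> pred (head t)"
  shows "expand_rule T c = c"
proof -
  have "expand T l = {l}" if "l \<in> body c" for l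
    using that assms instance_of_pred expand_other by metis
  then have "(\<Union>l\<in>body c. expand T l) = body c"
    by simp
  then show ?thesis
    by (cases c) (simp add: expand_rule_def fset_inverse)
qed

text \<open>Literals introduced by \<open>t\<close> carry body symbols, which are no head symbols,
  so the pass with \<open>T\<close> leaves them alone. Two successive passes thus amount to
  one.\<close>

lemma expand_insert:
  assumes T: "stratified (insert t T)" and "t \<notin> T"
  shows "(\<Union>k\<in>expand {t} l. expand T k) = expand (insert t T) l"
proof (cases "instance_of l (head t)")
  case True
  then obtain \<sigma> where l: "l = subst \<sigma> (head t)"
    unfolding instance_of_def by blast
  have "expand {t} l = subst \<sigma> ` body t"
    unfolding l by (rule expand_instance) (use T stratified_subset in blast)+
  moreover have "expand T (subst \<sigma> b) = {subst \<sigma> b}" if "b \<in> body t" for b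
  proof (rule expand_other)
    fix u assume "u \<in> T"
    then have "pred b \<noteq> pred (head u)"
      using T that unfolding stratified_def by blast
    then show "\<not> instance_of (subst \<sigma> b) (head u)"
      using instance_of_pred by fastforce
  qed
  moreover have "expand (insert t T) l = subst \<sigma> ` body t"
    unfolding l by (rule expand_instance[OF T]) simp
  ultimately show ?thesis
    by auto
next
  case False
  then show ?thesis
    by (auto simp: expand_def instance_of_def)
qed

lemma expand_rule_insert:
  assumes "stratified (insert t T)" and "t \<notin> T"
  shows "expand_rule T (expand_rule {t} c) = expand_rule (insert t T) c"
proof -
  have "stratified T" "stratified {t}"
    using assms(1) stratified_subset by blast+
  then show ?thesis
    using expand_insert[OF assms]
    by (intro rule.expand) (simp add: fset_inject[symmetric] body_expand_rule assms(1))
qed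

text \<open>A literal with the head symbol of a rule in \<open>T\<close> cannot come from the body
  of \<open>t\<close>, so it was already in \<open>c\<close>.\<close>

lemma expandable_expand_rule:
  assumes "stratified (insert t T)" and "expandable (insert t T) c"
  shows "expandable T (expand_rule {t} c)"
  unfolding expandable_def
proof (intro ballI impI)
  fix u l
  assume u: "u \<in> T" and l: "l \<in> body (expand_rule {t} c)" and p: "pred l = pred (head u)"
  have "stratified {t}"
    using assms(1) stratified_subset by blast
  with l obtain k where k: "k \<in> body c" "l \<in> expand {t} k"
    by (auto simp: body_expand_rule)
  have "pred b \<noteq> pred (head u)" if "b \<in> body t" for b
    using assms(1) u that unfolding stratified_def by blast
  with k(2) p have "l = k"
    unfolding expand_def by (auto split: if_splits)
  then show "instance_of l (head u)"
    using assms(2) u k(1) p unfolding expandable_def by blast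
qed

text \<open>
  The most general unifier maps the variables of the copies back to those of \<open>c\<close> and fixes all
  other variables, so that \<open>c\<close> itself is not renamed.
\<close>
lemma resolvent_expand_rule:
  fixes c t :: "('p, 'v::infinite) rule"
  assumes t: "stratified {t}" and c: "expandable {t} c"
  shows "resolvent c t (expand_rule {t} c)"
proof -
  define L where "L = resolved_literals c t"
  have L: "L = {a \<in> body c. pred a = pred (head t)}"
    by (simp add: L_def resolved_literals_eq)
  have "finite L"
    by (simp add: L)
  have vars: "rule_vars t = var (head t)"
    using t unfolding stratified_def rule_vars_def by blast
  have "\<forall>a\<in>L. \<exists>\<sigma>. a = subst \<sigma> (head t)"
    using c by (simp add: L expandable_def instance_of_def)
  then obtain s where s: "\<And>a. a \<in> L \<Longrightarrow> a = subst (s a) (head t)"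
    by metis
  \<comment> \<open>A single injection on pairs names the variables of all copies at once; different
    literals then get disjoint copies.\<close>
  obtain k :: "('p, 'v) literal \<times> 'v \<Rightarrow> 'v" where
    k: "inj_on k (L \<times> rule_vars t)" "k ` (L \<times> rule_vars t) \<inter> rule_vars c = {}"
    using exists_fresh_injection[of "L \<times> rule_vars t" "rule_vars c"] \<open>finite L\<close> by auto
  define \<rho> where "\<rho> a v = k (a, v)" for a v
  define \<theta> where "\<theta> x = (if x \<in> k ` (L \<times> rule_vars t)
    then (\<lambda>(a, v). s a v) (inv_into (L \<times> rule_vars t) k x) else x)" for x
  have \<theta>\<rho>: "\<theta> (\<rho> a v) = s a v" if "a \<in> L" "v \<in> rule_vars t" for a v
    using that k(1) by (simp add: \<theta>_def \<rho>_def)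
  have \<theta>_c: "\<theta> x = x" if "x \<in> rule_vars c" for x
    using that k(2) by (auto simp: \<theta>_def)
  have \<theta>_head: "subst \<theta> (head c) = head c"
    by (rule subst_ident, rule \<theta>_c) (simp add: rule_vars_def)
  have \<theta>_body: "subst \<theta> a = a" if "a \<in> body c" for a
    by (rule subst_ident, rule \<theta>_c) (use that in \<open>auto simp: rule_vars_def\<close>)
  have copy: "subst \<theta> (subst (\<rho> a) b) = subst (s a) b"
    if "a \<in> L" "var b \<subseteq> rule_vars t" for a b
    unfolding subst_subst by (rule subst_cong) (use that \<theta>\<rho> in auto)
  have "subst \<theta> a = subst \<theta> (subst (\<rho> a) (head t))" if "a \<in> L" for a
    using that copy[OF that, of "head t"] s[OF that] \<theta>_body[of a] L vars by simp
  then have "unifier \<theta> {(a, subst (\<rho> a) (head t)) | a. a \<in> L}"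
    by (auto simp: unifier_def)
  \<comment> \<open>The unifier \<open>\<tau>\<close> itself serves as the factor
    \<open>\<delta>\<close> in the definition of \<open>mgu\<close>.\<close>
  moreover have "\<tau> = \<tau> \<circ> \<theta>"
    if \<tau>: "unifier \<tau> {(a, subst (\<rho> a) (head t)) | a. a \<in> L}" for \<tau>
  proof
    fix x
    show "\<tau> x = (\<tau> \<circ> \<theta>) x"
    proof (cases "x \<in> k ` (L \<times> rule_vars t)")
      case True
      then obtain a v where av: "a \<in> L" "v \<in> rule_vars t" "x = \<rho> a v"
        by (auto simp: \<rho>_def)
      have "subst \<tau> (subst (\<rho> a) (head t)) = subst \<tau> (subst (s a) (head t))"
        using \<tau> s av(1) by (auto simp: unifier_def)
      then have "\<tau> (\<rho> a v) = \<tau> (s a v)"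
        using subst_eq_var[of "\<tau> \<circ> \<rho> a" "head t" "\<tau> \<circ> s a" v] av(2) vars
        by (simp add: subst_subst)
      then show ?thesis
        using av \<theta>\<rho> by simp
    qed (simp add: \<theta>_def)
  qed
  ultimately have mgu: "mgu \<theta> {(a, subst (\<rho> a) (head t)) | a. a \<in> L}"
    unfolding mgu_def by blast
  have "expand {t} l = {l}" if "l \<in> body c - L" for l
    using that instance_of_pred L by (intro expand_other) auto
  moreover have "expand {t} a = subst (s a) ` body t" if "a \<in> L" for a
    using expand_instance[OF t] s[OF that] by (metis singletonI)
  moreover have "body c = (body c - L) \<union> L"
    using L by blast
  ultimately have "body (expand_rule {t} c) = (body c - L) \<union> (\<Union>a\<in>L. subst (s a) ` body t)"
    unfolding body_expand_rule[OF t] by (metis (no_types, lifting) SUP_cong UN_Un UN_singleton)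
  moreover have "subst \<theta> ` (body c - L) = body c - L"
    using \<theta>_body by (simp add: image_cong)
  moreover have "subst \<theta> ` subst (\<rho> a) ` body t = subst (s a) ` body t" if "a \<in> L" for a
    unfolding image_image
    by (rule image_cong[OF refl], rule copy[OF that]) (auto simp: rule_vars_def)
  ultimately have bd: "body (expand_rule {t} c) =
      subst \<theta> ` (body c - L) \<union> (\<Union>a\<in>L. subst \<theta> ` subst (\<rho> a) ` body t)"
    by simp
  have "inj_on (\<rho> a) (rule_vars t) \<and> \<rho> a ` rule_vars t \<inter> rule_vars c = {}" if "a \<in> L" for a
    using that k unfolding \<rho>_def inj_on_def by blast
  moreover have "\<rho> a ` rule_vars t \<inter> \<rho> b ` rule_vars t = {}"
    if "a \<in> L" "b \<in> L" "a \<noteq> b" for a b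
    using that k(1) unfolding \<rho>_def inj_on_def by blast
  ultimately show ?thesis
    unfolding resolvent_def Let_def L_def[symmetric]
    using mgu bd \<theta>_head by (intro exI[of _ \<rho>] exI[of _ \<theta>]) simp
qed

text \<open>Each pass is a valid unfolding by \<open>resolvent_expand_rule\<close>, and
  \<open>expand_rule_insert\<close> merges the passes. The result depends only on the set of rules,
  not on their order.\<close>

lemma unfold_list_expand_rule:
  fixes N :: "('p, 'v::infinite) rule set"
  assumes "stratified (set rs)" and "distinct rs" and "\<And>c. c \<in> N \<Longrightarrow> expandable (set rs) c"
  shows "unfold_list N rs (expand_rule (set rs) ` N)"
  using assms
proof (induction rs arbitrary: N)
  case Nil
  have "expand_rule {} c = c" for c :: "('p, 'v) rule"
    by (rule expand_rule_ident) simp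
  then have "expand_rule {} ` N = N"
    by (simp add: image_def)
  then show ?case
    by (simp add: unfold_list.intros)
next
  case (Cons t rs)
  have ind: "stratified (insert t (set rs))" and t: "t \<notin> set rs"
    and ex: "\<And>c. c \<in> N \<Longrightarrow> expandable (insert t (set rs)) c"
    using Cons.prems by auto
  have ind1: "stratified {t}" and ind2: "stratified (set rs)"
    using ind stratified_subset by blast+
  have "unfold_upon N t (expand_rule {t} ` N)"
    unfolding unfold_upon_def
  proof (intro conjI exI ballI)
    show "(\<Union>a\<in>body t. var a) \<subseteq> var (head t)"
      using ind1 by (simp add: stratified_def)
  next
    fix c assume "c \<in> N"
    then have "expandable {t} c"
      using ex unfolding expandable_def by blast
    then show "if resolved_literals c t \<noteq> {} then resolvent c t (expand_rule {t} c)
               else expand_rule {t} c = c"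
      using resolvent_expand_rule[OF ind1]
      by (auto simp: resolved_literals_eq intro!: expand_rule_ident)
  qed simp
  moreover have "unfold_list (expand_rule {t} ` N) rs (expand_rule (set rs) ` expand_rule {t} ` N)"
  proof (rule Cons.IH[OF ind2])
    show "distinct rs"
      using Cons.prems(2) by simp
    show "expandable (set rs) c" if "c \<in> expand_rule {t} ` N" for c
      using that expandable_expand_rule[OF ind ex] by blast
  qed
  moreover have "expand_rule (set rs) ` expand_rule {t} ` N = expand_rule (set (t # rs)) ` N"
    by (simp add: image_image expand_rule_insert[OF ind t])
  ultimately show ?case
    by (metis unfold_list.intros(2))
qed

lemma unfold_expand_rule:
  fixes N :: "('p, 'v::infinite) rule set"
  assumes "stratified T" and "finite T" and "\<And>c. c \<in> N \<Longrightarrow> expandable T c"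
  shows "unfold N T (expand_rule T ` N)"
proof -
  obtain rs where "distinct rs" "set rs = T"
    using assms(2) finite_distinct_list by metis
  then show ?thesis
    unfolding unfold_def using unfold_list_expand_rule[of rs N] assms by metis
qed

section \<open>The parts of an unfolded rule\<close>

text \<open>Unfolding treats the rules of a program independently; this relation follows a single
  one of them.\<close>

fun unfolds_to :: "('p, 'v) rule list \<Rightarrow> ('p, 'v) rule \<Rightarrow> ('p, 'v) rule \<Rightarrow> bool" where
  "unfolds_to [] c d \<longleftrightarrow> c = d"
| "unfolds_to (r # rs) c d \<longleftrightarrow>
     (\<exists>e. (if resolved_literals c r \<noteq> {} then resolvent c r e else e = c) \<and> unfolds_to rs e d)"

lemma unfold_list_image:
  "unfold_list N rs T \<Longrightarrow> \<exists>F. T = F ` N \<and> (\<forall>c\<in>N. unfolds_to rs c (F c))"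
proof (induction rule: unfold_list.induct)
  case (1 P)
  show ?case
    by (rule exI[of _ "\<lambda>c. c"]) simp
next
  case (2 P r P' rs T)
  then obtain d F where
    dF: "P' = d ` P" "\<forall>c\<in>P. if resolved_literals c r \<noteq> {} then resolvent c r (d c) else d c = c"
    "T = F ` P'" "\<forall>c\<in>P'. unfolds_to rs c (F c)"
    unfolding unfold_upon_def by blast
  have "unfolds_to (r # rs) c (F (d c))" if "c \<in> P" for c
    unfolding unfolds_to.simps by (rule exI[of _ "d c"]) (use dF that in blast)
  then show ?case
    using dF by (intro exI[of _ "F \<circ> d"]) (simp add: image_comp)
qed

text \<open>
  All literals with a predicate symbol in \<open>A\<close> need the same substitution \<open>\<tau>\<close>: the body literals of
  an invented rule are among them, and the part that replaces its head must be a single instance of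
  its body.
\<close>
lemma unfolds_to_parts:
  fixes c d :: "('p, 'v::infinite) rule"
  assumes "unfolds_to rs c d"
    and "\<And>r. r \<in> set rs \<Longrightarrow> pred (head r) \<notin> A \<and> pred ` body r \<subseteq> A"
    and "pred ` body d \<subseteq> A"
  shows "\<exists>\<tau> E. body d = (\<Union>a\<in>body c. E a) \<and>
    (\<forall>a\<in>body c. if pred a \<in> A then E a = {subst \<tau> a}
                 else \<exists>r\<in>set rs. \<exists>\<sigma>. E a = subst \<sigma> ` body r)"
  using assms
proof (induction rs arbitrary: c)
  case Nil
  \<comment> \<open>With no rules left, \<open>c\<close> equals \<open>d\<close>, whose body symbols
    all lie in \<open>A\<close>; the second alternative is vacuous.\<close>
  then show ?case
    by (intro exI[of _ id] exI[of _ "\<lambda>a. {a}"]) (auto simp: subst_ident)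
next
  case (Cons r rs)
  then obtain e where
    e: "if resolved_literals c r \<noteq> {} then resolvent c r e else e = c" "unfolds_to rs e d"
    by auto
  have "\<exists>\<tau> E. body d = (\<Union>a\<in>body e. E a) \<and>
    (\<forall>a\<in>body e. if pred a \<in> A then E a = {subst \<tau> a}
                 else \<exists>r\<in>set rs. \<exists>\<sigma>. E a = subst \<sigma> ` body r)"
    using Cons.IH[OF e(2)] Cons.prems(2,3) by simp
  then obtain \<tau> E where E: "body d = (\<Union>a\<in>body e. E a)"
    "\<And>a. a \<in> body e \<Longrightarrow> pred a \<in> A \<Longrightarrow> E a = {subst \<tau> a}"
    "\<And>a. a \<in> body e \<Longrightarrow> pred a \<notin> A \<Longrightarrow> \<exists>r\<in>set rs. \<exists>\<sigma>. E a = subst \<sigma> ` body r"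
    by metis
  show ?case
  proof (cases "resolved_literals c r = {}")
    case True
    then show ?thesis
      using e(1) E by (intro exI[of _ \<tau>] exI[of _ E]) auto
  next
    case False
    define L where "L = resolved_literals c r"
    obtain \<rho> \<theta> where
      be: "body e = subst \<theta> ` (body c - L) \<union> (\<Union>a\<in>L. subst \<theta> ` subst (\<rho> a) ` body r)"
      using False e(1) unfolding resolvent_def Let_def L_def by auto
    have L: "L = {a \<in> body c. pred a = pred (head r)}"
      by (simp add: L_def resolved_literals_eq)
    \<comment> \<open>A resolved literal becomes a copy of the body of \<open>r\<close>. Its symbols
      lie in \<open>A\<close>, so the remaining unfoldings only apply \<open>\<tau>\<close> to it.
      An unresolved literal keeps the part of its image under \<open>\<theta>\<close>.\<close>
    define E' where "E' a = (if a \<in> L then subst (\<tau> \<circ> \<theta> \<circ> \<rho> a) ` body r else E (subst \<theta> a))" for a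
    have Er: "(\<Union>b\<in>body r. E (subst \<theta> (subst (\<rho> a) b))) = E' a" if "a \<in> L" for a
    proof -
      have "E (subst \<theta> (subst (\<rho> a) b)) = {subst (\<tau> \<circ> \<theta> \<circ> \<rho> a) b}" if b: "b \<in> body r" for b
      proof -
        have "subst \<theta> (subst (\<rho> a) b) \<in> body e"
          using \<open>a \<in> L\<close> b be by blast
        moreover have "pred b \<in> A"
          using Cons.prems(2)[of r] b by auto
        ultimately show ?thesis
          using E(2) by (simp add: subst_subst comp_assoc)
      qed
      then show ?thesis
        using that by (auto simp: E'_def)
    qed
    have "body c = (body c - L) \<union> L"
      using L by blast
    then have "(\<Union>a\<in>body c. E' a) = (\<Union>a\<in>body c - L. E' a) \<union> (\<Union>a\<in>L. E' a)"
      by (metis UN_Un)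
    moreover have "body d = (\<Union>a\<in>body c - L. E (subst \<theta> a)) \<union>
        (\<Union>a\<in>L. \<Union>b\<in>body r. E (subst \<theta> (subst (\<rho> a) b)))"
      unfolding E(1) be by blast
    ultimately have "body d = (\<Union>a\<in>body c. E' a)"
      using Er by (auto simp: E'_def)
    moreover have "E' a = {subst (\<tau> \<circ> \<theta>) a}" if "a \<in> body c" "pred a \<in> A" for a
    proof -
      \<comment> \<open>Resolved literals carry the head symbol of \<open>r\<close>, which is
        outside \<open>A\<close>.\<close>
      have "a \<notin> L"
        using that L Cons.prems(2)[of r] by auto
      then have "subst \<theta> a \<in> body e"
        using that be by blast
      then show ?thesis
        using E(2) that \<open>a \<notin> L\<close> by (simp add: E'_def subst_subst)
    qed
    moreover have "\<exists>q\<in>set (r # rs). \<exists>\<sigma>. E' a = subst \<sigma> ` body q"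
      if "a \<in> body c" "pred a \<notin> A" for a
    proof (cases "a \<in> L")
      case True
      then show ?thesis
        by (auto simp: E'_def)
    next
      case False
      then have "subst \<theta> a \<in> body e"
        using that be by blast
      then show ?thesis
        using E(3)[of "subst \<theta> a"] that False by (simp add: E'_def)
    qed
    ultimately show ?thesis
      by (intro exI[of _ "\<tau> \<circ> \<theta>"] exI[of _ E']) simp
  qed
qed

section \<open>Linearising a refactored program\<close>

text \<open>Two occurrences of a variable would be counted twice: as two summands if they lie in
  different literals, within one \<open>count_list\<close> otherwise.\<close>

lemma linear_position_unique:
  fixes t :: "('p, 'v) rule"
  assumes lin: "\<And>x. (\<Sum>a\<in>body t. count_list (args a) x) \<le> 1"
    and "a \<in> body t" "b \<in> body t" "i < length (args a)" "j < length (args b)"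
    and eq: "args a ! i = args b ! j"
  shows "a = b \<and> i = j"
proof -
  let ?x = "args a ! i"
  have pos: "count_list (args l) ?x \<noteq> 0" if "?x \<in> set (args l)" for l :: "('p, 'v) literal"
    using that by (simp add: count_list_0_iff)
  have ina: "?x \<in> set (args a)"
    using assms(4) by (rule nth_mem)
  have inb: "?x \<in> set (args b)"
    unfolding eq using assms(5) by (rule nth_mem)
  have "a = b"
  proof (rule ccontr)
    assume "a \<noteq> b"
    have "(\<Sum>l\<in>{a, b}. count_list (args l) ?x) \<le> (\<Sum>l\<in>body t. count_list (args l) ?x)"
      using assms by (intro sum_mono2) auto
    then show False
      using \<open>a \<noteq> b\<close> lin[of ?x] pos[OF ina] pos[OF inb] by simp
  qed
  have "count_list (args a) ?x \<le> (\<Sum>l\<in>body t. count_list (args l) ?x)"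
    using assms by (intro member_le_sum) auto
  then have "count_list (args a) ?x \<le> 1"
    using lin[of ?x] by linarith
  moreover have "count_list (args a) ?x = card {k. k < length (args a) \<and> args a ! k = ?x}"
    unfolding count_list_eq_length_filter length_filter_conv_card by (metis (no_types))
  ultimately have "card {k. k < length (args a) \<and> args a ! k = ?x} \<le> Suc 0"
    by simp
  then have "i = j"
    using assms \<open>a = b\<close> card_le_Suc0_iff_eq[of "{k. k < length (args a) \<and> args a ! k = ?x}"] by auto
  with \<open>a = b\<close> show ?thesis ..
qed

text \<open>Every variable in the body of \<open>t\<close> has a single position, which
  \<open>f\<close> matches with a position in the body of \<open>r\<close>. A substitution on
  \<open>t\<close> can thus prescribe each position freely and copy what \<open>\<sigma>\<close>
  puts there.\<close>

lemma linearisation_instance: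
  assumes "linearisation P r t"
  shows "\<exists>\<sigma>'. subst \<sigma>' ` body t = subst \<sigma> ` body r"
proof -
  from assms obtain f where
    lin: "\<And>x. (\<Sum>a\<in>body t. count_list (args a) x) \<le> 1" and
    f: "bij_betw f (body r) (body t)" "\<And>a. a \<in> body r \<Longrightarrow> pred (f a) = pred a"
    unfolding linearisation_def linear_invented_rule_def by auto
  define Occ where "Occ x a i \<longleftrightarrow> a \<in> body r \<and> i < length (args a) \<and> args (f a) ! i = x" for x a i
  \<comment> \<open>The choice is forced for variables occurring in the body of \<open>t\<close>;
    the value at other variables is arbitrary and does not affect the instance.\<close>
  define \<sigma>' where "\<sigma>' x = (case SOME (a, i). Occ x a i of (a, i) \<Rightarrow> \<sigma> (args a ! i))" for x
  have len: "length (args (f a)) = length (args a)" if "a \<in> body r" for a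
    using f(2)[OF that] by (simp add: pred_def)
  have fb: "f a \<in> body t" if "a \<in> body r" for a
    using f(1) that by (auto simp: bij_betw_def)
  have \<sigma>': "\<sigma>' (args (f a) ! i) = \<sigma> (args a ! i)" if "a \<in> body r" "i < length (args a)" for a i
  proof -
    have "Occ (args (f a) ! i) b j \<longleftrightarrow> b = a \<and> j = i" for b j
    proof
      assume o: "Occ (args (f a) ! i) b j"
      then have "f b = f a \<and> j = i"
        using linear_position_unique[OF lin, of "f b" "f a" j i] that fb len
        by (auto simp: Occ_def)
      then show "b = a \<and> j = i"
        using f(1) o that by (auto simp: Occ_def bij_betw_def inj_on_def)
    qed (use that in \<open>auto simp: Occ_def\<close>)
    then have "(SOME (b, j). Occ (args (f a) ! i) b j) = (a, i)"
      by (auto intro!: some_equality)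
    then show ?thesis
      by (simp add: \<sigma>'_def)
  qed
  have "subst \<sigma>' (f a) = subst \<sigma> a" if "a \<in> body r" for a
  proof -
    have "sym (f a) = sym a"
      using f(2)[OF that] by (simp add: pred_def)
    moreover have "map \<sigma>' (args (f a)) = map \<sigma> (args a)"
      using \<sigma>' that len by (intro nth_equalityI) auto
    ultimately show ?thesis
      by (simp add: subst_def)
  qed
  moreover have "body t = f ` body r"
    using f(1) by (simp add: bij_betw_def)
  ultimately show ?thesis
    by (intro exI[of _ \<sigma>']) (auto simp: image_image)
qed

lemma linearisation_rule_size: "linearisation P r t \<Longrightarrow> rule_size t = rule_size r"
  unfolding linearisation_def rule_size_def using bij_betw_same_card by fastforce

lemma linearisation_invented: "linearisation P r t \<Longrightarrow> \<exists>Y. invented_rule P Y t"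
  unfolding linearisation_def linear_invented_rule_def by blast

text \<open>Body symbols occur in \<open>P\<close> and head symbols do not, which separates the two.
  Uniqueness of the rule for a head symbol is the second clause of
  \<open>linearises\<close>.\<close>

lemma stratified_linearises:
  assumes "linearises P S lin"
  shows "stratified (lin ` S)"
proof -
  have inv: "\<exists>Y. invented_rule P Y (lin s)" if "s \<in> S" for s
    using assms that linearisation_invented unfolding linearises_def by blast
  have "(\<Union>b\<in>body (lin s). var b) \<subseteq> var (head (lin s))" if "s \<in> S" for s
    using inv[OF that] by (auto simp: invented_rule_def)
  moreover have "pred b \<noteq> pred (head (lin u))" if "s \<in> S" "u \<in> S" "b \<in> body (lin s)" for s u b
    using inv[OF that(1)] inv[OF that(2)] that(3) by (auto simp: invented_rule_def)
  ultimately show ?thesis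
    using assms unfolding stratified_def linearises_def by blast
qed

lemma linearise_rule:
  fixes c d :: "('p, 'v::infinite) rule"
  assumes inv: "\<And>s. s \<in> set rs \<Longrightarrow> invented_rule P X s"
    and lin: "linearises P S lin" and rs: "set rs \<subseteq> S"
    and cd: "unfolds_to rs c d" and d: "d \<in> P"
  shows "\<exists>c'. rule_size c' \<le> rule_size c \<and> head c' = head d \<and>
    (\<forall>T. lin ` set rs \<subseteq> T \<and> T \<subseteq> lin ` S \<longrightarrow> expandable T c' \<and> expand_rule T c' = d)"
proof -
  let ?A = "preds P"
  have r: "pred (head r) \<notin> ?A \<and> pred ` body r \<subseteq> ?A" if "r \<in> set rs" for r
    using inv[OF that] by (auto simp: invented_rule_def)
  have dA: "pred ` body d \<subseteq> ?A"
    using d by (auto simp: preds_def)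
  have tA: "pred (head t) \<notin> ?A" if "t \<in> lin ` S" for t
    using that lin linearisation_invented unfolding linearises_def invented_rule_def by blast
  obtain \<tau> E where E: "body d = (\<Union>a\<in>body c. E a)"
    "\<And>a. a \<in> body c \<Longrightarrow> pred a \<in> ?A \<Longrightarrow> E a = {subst \<tau> a}"
    "\<And>a. a \<in> body c \<Longrightarrow> pred a \<notin> ?A \<Longrightarrow> \<exists>r\<in>set rs. \<exists>\<sigma>. E a = subst \<sigma> ` body r"
    using unfolds_to_parts[OF cd r dA] by metis
  \<comment> \<open>The literal \<open>l\<close> is the replacement for \<open>a\<close>: the
    surviving literal itself, or the instance of a linear head that expands to the part
    \<open>E a\<close>.\<close>
  have "\<exists>l. pred l \<in> ?A \<and> E a = {l} \<or>
            (\<exists>t\<in>lin ` set rs. \<exists>\<sigma>. l = subst \<sigma> (head t) \<and> E a = subst \<sigma> ` body t)"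
    if a: "a \<in> body c" for a
  proof (cases "pred a \<in> ?A")
    case True
    then show ?thesis
      using E(2)[OF a] by (intro exI[of _ "subst \<tau> a"]) simp
  next
    case False
    then obtain q \<sigma> where q: "q \<in> set rs" "E a = subst \<sigma> ` body q"
      using E(3)[OF a] by blast
    then have "linearisation P q (lin q)"
      using lin rs unfolding linearises_def by blast
    then obtain \<sigma>' where "subst \<sigma>' ` body (lin q) = subst \<sigma> ` body q"
      using linearisation_instance by blast
    then show ?thesis
      using q by (metis imageI)
  qed
  then obtain g where g: "\<And>a. a \<in> body c \<Longrightarrow> pred (g a) \<in> ?A \<and> E a = {g a} \<or>
      (\<exists>t\<in>lin ` set rs. \<exists>\<sigma>. g a = subst \<sigma> (head t) \<and> E a = subst \<sigma> ` body t)"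
    by metis
  \<comment> \<open>The head comes from \<open>d\<close>, since the unifiers may have renamed that
    of \<open>c\<close> while matching leaves heads fixed. The map \<open>g\<close> may merge body
    literals, which only lowers the size.\<close>
  define c' where "c' = Rule (head d) (g |`| fbody c)"
  have bc': "body c' = g ` body c"
    by (simp add: c'_def)
  have "rule_size c' \<le> rule_size c"
    by (simp add: rule_size_def bc' card_image_le)
  moreover have "expandable T c' \<and> expand_rule T c' = d"
    if T: "lin ` set rs \<subseteq> T" "T \<subseteq> lin ` S" for T
  proof
    have ind: "stratified T"
      using stratified_subset[OF stratified_linearises[OF lin] T(2)] .
    show "expandable T c'"
      unfolding expandable_def
    proof (intro ballI impI)
      fix t l assume t: "t \<in> T" and "l \<in> body c'" and p: "pred l = pred (head t)"
      then obtain a where a: "a \<in> body c" "l = g a"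
        using bc' by blast
      have "pred (g a) \<notin> ?A"
        using t T tA p a by auto
      then obtain u \<sigma> where u: "u \<in> lin ` set rs" "l = subst \<sigma> (head u)"
        using g[OF a(1)] a(2) by blast
      then have "u = t"
        using ind t T p unfolding stratified_def by (metis pred_subst subsetD)
      then show "instance_of l (head t)"
        using u unfolding instance_of_def by blast
    qed
    have "expand T (g a) = E a" if a: "a \<in> body c" for a
      using g[OF a]
    proof
      assume "pred (g a) \<in> ?A \<and> E a = {g a}"
      then show ?thesis
        using tA T instance_of_pred expand_other by (metis subsetD)
    next
      assume "\<exists>t\<in>lin ` set rs. \<exists>\<sigma>. g a = subst \<sigma> (head t) \<and> E a = subst \<sigma> ` body t"
      then show ?thesis
        using expand_instance[OF ind] T by (metis subsetD)
    qed
    then have "body (expand_rule T c') = body d"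
      by (simp add: body_expand_rule[OF ind] bc' E(1))
    then show "expand_rule T c' = d"
      by (intro rule.expand) (simp add: fset_inject c'_def)
  qed
  ultimately show ?thesis
    by (intro exI[of _ c']) (auto simp: c'_def)
qed

lemma linearise_refactored_program:
  fixes P S Q :: "('p, 'v::infinite) rule set"
  assumes finS: "finite S" and inv: "\<forall>s\<in>S. invented_rule P X s"
    and lin: "linearises P S lin" and Q: "refactored_program P S Q"
  shows "\<exists>R. refactored_program P (lin ` S) R \<and> prog_size R \<le> prog_size Q"
proof -
  define C where "C = Q \<inter> S"
  have finQ: "finite Q" and un: "unfold (Q - S) C P"
    using Q by (auto simp: refactored_program_def C_def)
  then obtain rs where rs: "set rs = C" "unfold_list (Q - S) rs P"
    by (auto simp: unfold_def)
  then obtain F where F: "P = F ` (Q - S)" "\<forall>c\<in>Q - S. unfolds_to rs c (F c)"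
    using unfold_list_image by blast
  have "\<exists>c'. rule_size c' \<le> rule_size c \<and> head c' = head (F c) \<and>
    (\<forall>T. lin ` C \<subseteq> T \<and> T \<subseteq> lin ` S \<longrightarrow> expandable T c' \<and> expand_rule T c' = F c)"
    if "c \<in> Q - S" for c
    using linearise_rule[of rs P X S lin c "F c"] that F inv lin rs(1) by (auto simp: C_def)
  then obtain G where G: "\<And>c. c \<in> Q - S \<Longrightarrow> rule_size (G c) \<le> rule_size c"
    "\<And>c. c \<in> Q - S \<Longrightarrow> head (G c) = head (F c)"
    "\<And>c T. c \<in> Q - S \<Longrightarrow> lin ` C \<subseteq> T \<Longrightarrow> T \<subseteq> lin ` S \<Longrightarrow> expandable T (G c) \<and> expand_rule T (G c) = F c"
    by metis
  define N where "N = G ` (Q - S)"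
  define R where "R = N \<union> lin ` C"
  have CS: "lin ` C \<subseteq> lin ` S"
    by (auto simp: C_def)
  have ind: "stratified (lin ` S)" "stratified (lin ` C)"
    using stratified_linearises[OF lin] stratified_subset CS by blast+
  have finC: "finite (lin ` C)"
    using finS by (simp add: C_def)
  \<comment> \<open>The heads tell the two kinds of rules apart: those in \<open>N\<close> have head
    symbols of \<open>P\<close>, linear rules have new ones.\<close>
  have "N \<inter> lin ` S = {}"
  proof -
    have "pred (head c) \<in> preds P" if "c \<in> N" for c
      using that G(2) F(1) by (auto simp: N_def preds_def)
    moreover have "pred (head t) \<notin> preds P" if "t \<in> lin ` S" for t
      using that lin linearisation_invented unfolding linearises_def invented_rule_def by blast
    ultimately show ?thesis
      by blast
  qed
  then have RS: "R - lin ` S = N" "R \<inter> lin ` S = lin ` C"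
    using CS by (auto simp: R_def)
  have "unfold N (lin ` C) (expand_rule (lin ` C) ` N)"
    by (rule unfold_expand_rule[OF ind(2) finC]) (use G(3) CS in \<open>auto simp: N_def\<close>)
  moreover have "expand_rule (lin ` C) ` N = P"
    unfolding F(1) N_def image_image using G(3) CS by (intro image_cong) auto
  moreover have "G c \<in> refactored_rules P (lin ` S)" if "c \<in> Q - S" for c
  proof -
    have "unfold {G c} (lin ` S) {F c}"
      using unfold_expand_rule[OF ind(1), of "{G c}"] finS G(3)[OF that CS] by simp
    then show ?thesis
      using that F(1) unfolding refactored_rules_def refactored_rule_def by blast
  qed
  ultimately have "refactored_program P (lin ` S) R"
    unfolding refactored_program_def RS using finQ finC CS by (auto simp: R_def N_def)
  moreover have "prog_size R \<le> prog_size Q"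
  \<comment> \<open>Both \<open>G\<close> and \<open>lin\<close> may identify rules, so sums over
    their images are only bounded by sums over the originals. Linearising preserves the size of each
    invented rule.\<close>
  proof -
    have "prog_size R \<le> prog_size N + prog_size (lin ` C)"
      using finQ finC unfolding R_def N_def prog_size_def by (simp add: sum_Un_nat)
    also have "prog_size N \<le> (\<Sum>c\<in>Q - S. rule_size (G c))"
      using finQ sum_image_le[of "Q - S" rule_size G] by (simp add: N_def prog_size_def)
    also have "\<dots> \<le> prog_size (Q - S)"
      unfolding prog_size_def by (rule sum_mono) (rule G(1))
    also have "prog_size (lin ` C) \<le> (\<Sum>c\<in>C. rule_size (lin c))"
      using finS sum_image_le[of C rule_size lin] by (simp add: C_def prog_size_def)
    also have "\<dots> = prog_size C"
      unfolding prog_size_def using lin linearisation_rule_size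
      by (intro sum.cong) (auto simp: linearises_def C_def)
    also have "prog_size (Q - S) + prog_size C = prog_size Q"
      using finQ sum.Int_Diff[of Q rule_size S] by (simp add: prog_size_def C_def)
    finally show ?thesis
      by simp
  qed
  ultimately show ?thesis
    by blast
qed

theorem theorem2:
  fixes P S C Q :: "('p, 'v::infinite) rule set"
    and X :: "'v set"
    and lin :: "('p, 'v) rule \<Rightarrow> ('p, 'v) rule"
  assumes "finite P"
    and "finite S"
    and "finite X"
    and "\<forall>s\<in>S. invented_rule P X s"
    and "linearises P S lin"
    and "C \<subseteq> S"
    and "optimal_refactoring P S Q"
    and "Q \<inter> S = C"
  shows "\<exists>Q' C'. C' \<subseteq> lin ` S \<and>
                 optimal_refactoring P (lin ` S) Q' \<and>
                 Q' \<inter> lin ` S = C' \<and>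
                 prog_size Q' \<le> prog_size Q"
proof -
  have "refactored_program P S Q"
    using assms(7) by (simp add: optimal_refactoring_def)
  then obtain R where R: "refactored_program P (lin ` S) R" "prog_size R \<le> prog_size Q"
    using linearise_refactored_program assms by blast
  from ex_has_least_nat[of "refactored_program P (lin ` S)", OF R(1)]
  obtain Q' where "refactored_program P (lin ` S) Q'"
    "\<forall>R. refactored_program P (lin ` S) R \<longrightarrow> prog_size Q' \<le> prog_size R"
    by blast
  then have "optimal_refactoring P (lin ` S) Q'" "prog_size Q' \<le> prog_size Q"
    using R by (auto simp: optimal_refactoring_def intro: le_trans)
  then show ?thesis
    by blast
qed

end
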